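(* Let $A\in\mathbb{R}^{m\times n}$, $m\ge n$, and let $A=W\Theta V^{\top}$, $\Theta=\mathrm{diag}(\theta_1,\ldots,\theta_n)$, be the $S^{\top}S$-SVD of $A$, where $S\in\mathbb{R}^{s\times m}$ is a randomized $(\varepsilon,\delta,\mathrm{rank}(A))$-subspace embedding of $\mathrm{Range}(A)$. Let $$\mathcal{Q}_S(A)=\{Q\in\mathbb{R}^{m\times n}\,:\,Q=WLV^{\top}\ \text{with}\ L\in\mathbb{R}^{n\times n},\ L^{\top}L=I\}.$$ Let $P=WV^{\top}\in\mathcal{Q}_S(A)$ and $H=V\Theta V^{\top}$, so that $A=PH$. Then with high probability, for both $*=2$ and $*=F$, $$\|A-P\|_{S,*}=\min_{Q\in\mathcal{Q}_S(A)}\|A-Q\|_{S,*}.$$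
   Context: Subspace embedding: let $\mathcal{V}$ be a $k$-dimensional subspace of $\mathbb{R}^m$, $\varepsilon\in(0,1)$ and $s\le m$. A (random) linear map $S\in\mathbb{R}^{s\times m}$ is an $(\varepsilon,\delta,k)$-subspace embedding for $\mathcal{V}$ if $(1-\varepsilon)\|v\|^2\le\|Sv\|^2\le(1+\varepsilon)\|v\|^2$ for all $v\in\mathcal{V}$ holds with probability at least $1-\delta$ (Euclidean norms). "With high probability" refers to the event that the embedding inequality (and hence the $S^{\top}S$-SVD) holds. Norms: for a matrix $B$, $\|B\|_{S,F}^2=\mathrm{trace}(B^{\top}S^{\top}SB)$ and $\|B\|_{S,2}^2=\max_{\|x\|_2=1}x^{\top}B^{\top}S^{\top}SBx$. The $S^{\top}S$-SVD of $A$ is the factorization $A=W\Theta V^{\top}$ (holding with probability $1-\delta$), with $W\in\mathbb{R}^{m\times n}$ satisfying $W^{\top}S^{\top}SW=I$, $V\in\mathbb{R}^{n\times n}$ satisfying $V^{\top}V=I$, and $\Theta=\mathrm{diag}(\theta_1,\ldots,\theta_n)$, $\theta_1\ge\ldots\ge\theta_n\ge0$. *)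

theory Defs
  imports "HOL-Probability.Probability"
begin

definition embeds :: "real \<Rightarrow> real^'m^'s \<Rightarrow> (real^'m) set \<Rightarrow> bool" where
  "embeds \<epsilon> S U \<longleftrightarrow>
     (\<forall>v\<in>U. (1 - \<epsilon>) * (norm v)\<^sup>2 \<le> (norm (S *v v))\<^sup>2 \<and>
             (norm (S *v v))\<^sup>2 \<le> (1 + \<epsilon>) * (norm v)\<^sup>2)"

definition embedding_event ::
    "'w measure \<Rightarrow> ('w \<Rightarrow> real^'m^'s) \<Rightarrow> real \<Rightarrow> (real^'m) set \<Rightarrow> 'w set" where
  "embedding_event M S \<epsilon> U = {\<omega> \<in> space M. embeds \<epsilon> (S \<omega>) U}"

text \<open>A random \<open>s \<times> m\<close> matrix is a Borel measurable map from a probability space into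
  \<^typ>\<open>real^'m^'s\<close>. The embedding event is then measurable, so \<^const>\<open>measure\<close> below is its
  genuine probability (see \<open>embedding_event_sets\<close>).\<close>

definition random_subspace_embedding ::
    "'w measure \<Rightarrow> ('w \<Rightarrow> real^'m^'s) \<Rightarrow> real \<Rightarrow> real \<Rightarrow> nat \<Rightarrow> (real^'m) set \<Rightarrow> bool" where
  "random_subspace_embedding M S \<epsilon> \<delta> k U \<longleftrightarrow>
     prob_space M \<and> S \<in> borel_measurable M \<and>
     0 < \<epsilon> \<and> \<epsilon> < 1 \<and> CARD('s) \<le> CARD('m) \<and>
     subspace U \<and> dim U = k \<and>
     1 - \<delta> \<le> measure M (embedding_event M S \<epsilon> U)"

lemma embedding_event_sets:
  fixes S :: "'w \<Rightarrow> real^'m^'s"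
  assumes "S \<in> borel_measurable M"
  shows "embedding_event M S \<epsilon> U \<in> sets M"
proof -
  have "continuous_on UNIV (\<lambda>X :: real^'m^'s. X *v v)" for v
    unfolding matrix_vector_mult_def by (intro continuous_intros)
  then have "closed {X :: real^'m^'s. v \<in> U \<longrightarrow>
       (1 - \<epsilon>) * (norm v)\<^sup>2 \<le> (norm (X *v v))\<^sup>2 \<and>
       (norm (X *v v))\<^sup>2 \<le> (1 + \<epsilon>) * (norm v)\<^sup>2}" for v
    by (intro closed_Collect_imp closed_Collect_conj closed_Collect_le open_Collect_const
          continuous_intros)
  then have "closed {X :: real^'m^'s. embeds \<epsilon> X U}"
    unfolding embeds_def Ball_def by (intro closed_Collect_all)
  then have "S -` {X. embeds \<epsilon> X U} \<inter> space M \<in> sets M"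
    by (intro measurable_sets[OF assms] borel_closed)
  moreover have "S -` {X. embeds \<epsilon> X U} \<inter> space M = embedding_event M S \<epsilon> U"
    by (auto simp: embedding_event_def)
  ultimately show ?thesis by simp
qed

definition norm_SF :: "real^'m^'s \<Rightarrow> real^'n^'m \<Rightarrow> real" where
  "norm_SF S B = sqrt (trace (transpose B ** transpose S ** S ** B))"

definition norm_S2 :: "real^'m^'s \<Rightarrow> real^'n^'m \<Rightarrow> real" where
  "norm_S2 S B =
     sqrt (SUP x\<in>{x. norm x = 1}. x \<bullet> ((transpose B ** transpose S ** S ** B) *v x))"

text \<open>The supremum in \<^const>\<open>norm_S2\<close> is a maximum.\<close>

lemma norm_S2_attained:
  fixes B :: "real^'n^'m" and S :: "real^'m^'s"
  defines "q \<equiv> \<lambda>x. x \<bullet> ((transpose B ** transpose S ** S ** B) *v x)"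
  shows "\<exists>x. norm x = 1 \<and> (\<forall>y. norm y = 1 \<longrightarrow> q y \<le> q x) \<and> (norm_S2 S B)\<^sup>2 = q x"
proof -
  have "{x :: real^'n. norm x = 1} = sphere 0 1" by auto
  then have "compact {x :: real^'n. norm x = 1}" "{x :: real^'n. norm x = 1} \<noteq> {}"
    by simp_all
  moreover have "continuous_on {x. norm x = 1} q"
    unfolding q_def by (intro continuous_intros matrix_vector_mult_linear_continuous_on)
  ultimately obtain x where x: "norm x = 1" "\<And>y. norm y = 1 \<Longrightarrow> q y \<le> q x"
    using continuous_attains_sup[of "{x. norm x = 1}" q] by auto
  have "(SUP x\<in>{x. norm x = 1}. q x) = q x"
    using x by (intro cSup_eq_maximum) auto
  moreover have "q x = (norm (S *v (B *v x)))\<^sup>2"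
    unfolding q_def power2_norm_eq_inner
    by (simp add: matrix_vector_mul_assoc[symmetric] dot_lmul_matrix[symmetric]
          vector_transpose_matrix flip: transpose_matrix_vector)
  ultimately have "(norm_S2 S B)\<^sup>2 = q x"
    unfolding norm_S2_def q_def by simp
  with x show ?thesis by blast
qed

definition diag :: "real^'n \<Rightarrow> real^'n^'n" where
  "diag \<theta> = (\<chi> i j. if i = j then \<theta> $ i else 0)"

text \<open>The linear order on the column index type \<open>'n\<close> only serves to express that the diagonal
  entries are listed in nonincreasing order.\<close>

definition STS_SVD ::
    "real^'m^'s \<Rightarrow> real^('n::{finite,linorder})^'m \<Rightarrow>
     real^('n::{finite,linorder})^'m \<Rightarrow> real^('n::{finite,linorder}) \<Rightarrow>
     real^('n::{finite,linorder})^('n::{finite,linorder}) \<Rightarrow> bool" where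
  "STS_SVD S A W \<theta> V \<longleftrightarrow>
     A = W ** diag \<theta> ** transpose V \<and>
     transpose W ** transpose S ** S ** W = mat 1 \<and>
     transpose V ** V = mat 1 \<and>
     (\<forall>i j. i \<le> j \<longrightarrow> \<theta> $ j \<le> \<theta> $ i) \<and>
     (\<forall>i. 0 \<le> \<theta> $ i)"

text \<open>The set \<open>\<Q>\<^sub>S(A)\<close>; it depends on \<open>S\<close> and \<open>A\<close> through the factors \<open>W\<close> and \<open>V\<close> of the chosen
  factorization of \<open>A\<close>.\<close>

definition QS :: "real^'n^'m \<Rightarrow> real^'n^'n \<Rightarrow> (real^'n^'m) set" where
  "QS W V = {Q. \<exists>L :: real^'n^'n. Q = W ** L ** transpose V \<and> transpose L ** L = mat 1}"

end

theory Submission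
  imports Defs
begin

text \<open>Every competitor has the form \<open>Q = W L V\<^sup>T\<close> with \<open>L\<close> orthogonal, so that
  \<open>A - Q = W (\<Theta> - L) V\<^sup>T\<close>. Since \<open>W\<close> is orthonormal for the inner product given by \<open>S\<^sup>T S\<close> and
  \<open>V\<close> is orthogonal, both factors disappear from the sketched norms: the \<open>(S,2)\<close>-norm and the
  \<open>(S,F)\<close>-norm of \<open>W X V\<^sup>T\<close> are the ordinary spectral and Frobenius norms of the square matrix
  \<open>X\<close> (lemmas \<open>norm_sketch_factors\<close> and \<open>norm_SF_factors\<close>). It remains to compare \<open>\<Theta> - L\<close> with
  \<open>\<Theta> - I\<close>, the matrix belonging to \<open>P\<close>.

  One estimate settles both norms. The \<open>i\<close>-th column of \<open>\<Theta> - L\<close> is \<open>\<theta>\<^sub>i e\<^sub>i - L e\<^sub>i\<close>, the difference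
  of vectors of lengths \<open>\<theta>\<^sub>i\<close> and \<open>1\<close>; by the reverse triangle inequality its length is at least
  \<open>\<bar>\<theta>\<^sub>i - 1\<bar>\<close>, the length of the \<open>i\<close>-th column of \<open>\<Theta> - I\<close> (lemma \<open>norm_column_diag_minus\<close>). The squared
  Frobenius norm is the sum of the squared column lengths, hence is smallest for \<open>L = I\<close>. The
  spectral norm of the diagonal matrix \<open>\<Theta> - I\<close> is its largest column length, while the spectral
  norm of \<open>\<Theta> - L\<close> is at least each of its column lengths.

  This comparison is deterministic and is made outcome by outcome on the embedding event, whose
  probability is at least \<open>1 - \<delta>\<close> by the definition of a random subspace embedding.\<close>

lemma quadratic_form_gram:
  fixes B :: "real^'n^'m" and S :: "real^'m^'s"
  shows "x \<bullet> ((transpose B ** transpose S ** S ** B) *v x) = (norm (S *v (B *v x)))\<^sup>2"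
  unfolding power2_norm_eq_inner
  by (simp add: matrix_vector_mul_assoc[symmetric] dot_lmul_matrix[symmetric]
      vector_transpose_matrix flip: transpose_matrix_vector)

text \<open>The squared identity \<open>norm_S2_attained\<close> does not fix the sign of the norm; this version
  does, and thereby allows norms to be compared through single vectors.\<close>

lemma norm_S2_eq_max:
  fixes B :: "real^'n^'m" and S :: "real^'m^'s"
  obtains x where "norm x = 1" "norm_S2 S B = norm (S *v (B *v x))"
    "\<And>y. norm y = 1 \<Longrightarrow> norm (S *v (B *v y)) \<le> norm_S2 S B"
proof -
  obtain x :: "real^'n" where x: "norm x = 1"
    and max: "\<And>y. norm y = 1 \<Longrightarrow> (norm (S *v (B *v y)))\<^sup>2 \<le> (norm (S *v (B *v x)))\<^sup>2"
    using norm_S2_attained[where S = S and B = B] unfolding quadratic_form_gram by blast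
  have "(SUP x\<in>{x. norm x = 1}. (norm (S *v (B *v x)))\<^sup>2) = (norm (S *v (B *v x)))\<^sup>2"
    using x max by (intro cSup_eq_maximum) auto
  then have eq: "norm_S2 S B = norm (S *v (B *v x))"
    unfolding norm_S2_def quadratic_form_gram by simp
  show ?thesis
    using that[OF x eq] max unfolding eq by (simp add: power2_le_iff_abs_le)
qed

text \<open>Orthonormality of \<open>W\<close> for \<open>S\<^sup>T S\<close> cancels \<open>W\<close>. The factor \<open>V\<^sup>T\<close> survives in the argument;
  when \<open>V\<close> is orthogonal it maps the unit sphere onto itself and does not affect the maximum.\<close>

lemma norm_sketch_factors:
  fixes W :: "real^'n^'m" and S :: "real^'m^'s" and X :: "real^'n^'n"
  assumes "transpose W ** transpose S ** S ** W = mat 1"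
  shows "norm (S *v ((W ** X ** transpose V) *v x)) = norm (X *v (transpose V *v x))"
proof -
  have "(norm (S *v (W *v z)))\<^sup>2 = (norm z)\<^sup>2" for z
    unfolding quadratic_form_gram[symmetric] assms by (simp add: power2_norm_eq_inner)
  then show ?thesis
    by (simp add: matrix_vector_mul_assoc[symmetric])
qed

lemma trace_gram:
  fixes X :: "real^'n^'n"
  shows "trace (transpose X ** X) = (\<Sum>i\<in>UNIV. (norm (column i X))\<^sup>2)"
  by (simp add: trace_def matrix_matrix_mult_def transpose_def column_def
      power2_norm_eq_inner inner_vec_def)

text \<open>The Gram matrix of \<open>S W X V\<^sup>T\<close> is \<open>V (X\<^sup>T X) V\<^sup>T\<close>, and the trace is invariant under
  orthogonal conjugation.\<close>

lemma norm_SF_factors: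
  fixes W :: "real^'n^'m" and S :: "real^'m^'s" and V X :: "real^'n^'n"
  assumes W: "transpose W ** transpose S ** S ** W = mat 1" and V: "transpose V ** V = mat 1"
  shows "norm_SF S (W ** X ** transpose V) = sqrt (\<Sum>i\<in>UNIV. (norm (column i X))\<^sup>2)"
proof -
  have "transpose (W ** X ** transpose V) ** transpose S ** S ** (W ** X ** transpose V)
      = V ** transpose X ** (transpose W ** transpose S ** S ** W) ** X ** transpose V"
    by (simp add: matrix_transpose_mul matrix_mul_assoc)
  also have "\<dots> = V ** (transpose X ** X ** transpose V)"
    unfolding W by (simp add: matrix_mul_assoc)
  also have "trace \<dots> = trace (transpose X ** X ** (transpose V ** V))"
    unfolding trace_mul_sym[of V] by (simp add: matrix_mul_assoc)
  finally show ?thesis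
    unfolding norm_SF_def V by (simp add: trace_gram matrix_mul_assoc)
qed

lemma norm_axis: "norm (axis i c :: real^'n) = \<bar>c\<bar>"
  by (simp add: norm_eq_sqrt_inner inner_axis_axis)

lemma norm_mult_orthogonal:
  fixes U :: "real^'n^'n"
  assumes "transpose U ** U = mat 1"
  shows "norm (U *v x) = norm x"
proof -
  have "orthogonal_transformation ((*v) U)"
    using assms by (simp add: orthogonal_transformation_matrix orthogonal_matrix)
  then show ?thesis by (rule orthogonal_transformation_norm)
qed

lemma column_diag_minus_one: "column i (diag \<theta> - mat 1) = axis i (\<theta> $ i - 1)"
  by (vector column_def diag_def mat_def axis_def)

text \<open>Reverse triangle inequality for the column \<open>\<theta>\<^sub>i e\<^sub>i - L e\<^sub>i\<close>, whose second term is a unit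
  vector.\<close>

lemma norm_column_diag_minus:
  fixes L :: "real^'n^'n"
  assumes L: "transpose L ** L = mat 1" and "0 \<le> \<theta> $ i"
  shows "\<bar>\<theta> $ i - 1\<bar> \<le> norm (column i (diag \<theta> - L))"
proof -
  have "orthogonal_matrix L"
    using L by (simp add: orthogonal_matrix)
  then have "norm (column i L) = 1"
    by (simp add: orthogonal_matrix_orthonormal_columns)
  moreover have "column i (diag \<theta> - L) = axis i (\<theta> $ i) - column i L"
    by (vector column_def diag_def axis_def)
  ultimately show ?thesis
    using norm_triangle_ineq3[of "axis i (\<theta> $ i)" "column i L"] \<open>0 \<le> \<theta> $ i\<close>
    by (simp add: norm_axis)
qed

lemma norm_diag_minus_one_le:
  fixes x :: "real^'n"
  assumes "\<And>i. \<bar>\<theta> $ i - 1\<bar> \<le> c"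
  shows "norm ((diag \<theta> - mat 1) *v x) \<le> c * norm x"
proof -
  have "((diag \<theta> - mat 1) *v x) $ i = (\<theta> $ i - 1) * x $ i" for i
    by (simp add: matrix_vector_mult_diff_rdistrib algebra_simps)
       (simp add: matrix_vector_mult_def diag_def if_distrib[of "\<lambda>z. z * _"] cong: if_cong)
  \<comment> \<open>Index types are nonempty, so any index bounds \<open>c\<close> from below.\<close>
  moreover have "0 \<le> c"
    using assms[of undefined] by linarith
  ultimately have "norm ((diag \<theta> - mat 1) *v x) \<le> norm (c *\<^sub>R x)"
    using assms by (intro norm_le_componentwise_cart) (simp add: abs_mult mult_right_mono)
  with \<open>0 \<le> c\<close> show ?thesis by simp
qed

text \<open>The unit vector \<open>V e\<^sub>i\<close> makes the column \<open>i\<close> of \<open>\<Theta> - L\<close> visible to the \<open>(S,2)\<close>-norm; the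
  index with the largest \<open>\<bar>\<theta>\<^sub>i - 1\<bar>\<close> is the one to test.\<close>

lemma norm_S2_diag_minus_min:
  fixes W :: "real^'n^'m" and S :: "real^'m^'s" and V L :: "real^'n^'n"
  assumes W: "transpose W ** transpose S ** S ** W = mat 1" and V: "transpose V ** V = mat 1"
    and L: "transpose L ** L = mat 1" and \<theta>: "\<And>i. 0 \<le> \<theta> $ i"
  shows "norm_S2 S (W ** (diag \<theta> - mat 1) ** transpose V)
       \<le> norm_S2 S (W ** (diag \<theta> - L) ** transpose V)" (is "?l \<le> ?r")
proof -
  have "V ** transpose V = mat 1"
    using V by (simp add: matrix_left_right_inverse[of V])
  then have isometry: "norm (V *v x) = norm x" "norm (transpose V *v x) = norm x" for x
    using V by (simp_all only: norm_mult_orthogonal transpose_transpose)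
  obtain k where k: "\<And>i. \<bar>\<theta> $ i - 1\<bar> \<le> \<bar>\<theta> $ k - 1\<bar>"
  proof -
    have "Max (range (\<lambda>i. \<bar>\<theta> $ i - 1\<bar>)) \<in> range (\<lambda>i. \<bar>\<theta> $ i - 1\<bar>)"
      by (intro Max_in) auto
    then obtain k where "Max (range (\<lambda>i. \<bar>\<theta> $ i - 1\<bar>)) = \<bar>\<theta> $ k - 1\<bar>"
      by (rule imageE)
    moreover have "\<bar>\<theta> $ i - 1\<bar> \<le> Max (range (\<lambda>i. \<bar>\<theta> $ i - 1\<bar>))" for i
      by (intro Max_ge) auto
    ultimately show thesis using that by metis
  qed
  have "?l \<le> \<bar>\<theta> $ k - 1\<bar>"
  proof -
    obtain x where x: "norm x = 1"
      "?l = norm (S *v ((W ** (diag \<theta> - mat 1) ** transpose V) *v x))"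
      by (rule norm_S2_eq_max)
    have "?l \<le> \<bar>\<theta> $ k - 1\<bar> * norm (transpose V *v x)"
      unfolding x(2) norm_sketch_factors[OF W] using k by (rule norm_diag_minus_one_le)
    then show ?thesis by (simp only: isometry x(1) mult_1_right)
  qed
  also have "\<dots> \<le> norm (column k (diag \<theta> - L))"
    using L \<theta> by (rule norm_column_diag_minus)
  also have "\<dots> = norm (S *v ((W ** (diag \<theta> - L) ** transpose V) *v (V *v axis k 1)))"
    unfolding norm_sketch_factors[OF W] matrix_vector_mul_assoc[of "transpose V" V] V
    unfolding matrix_vector_mul_lid by (simp add: matrix_vector_mult_basis)
  also have "\<dots> \<le> ?r"
    by (rule norm_S2_eq_max[of S "W ** (diag \<theta> - L) ** transpose V"])
       (simp add: isometry norm_axis)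
  finally show ?thesis .
qed

lemma norm_SF_diag_minus_min:
  fixes W :: "real^'n^'m" and S :: "real^'m^'s" and V L :: "real^'n^'n"
  assumes W: "transpose W ** transpose S ** S ** W = mat 1" and V: "transpose V ** V = mat 1"
    and L: "transpose L ** L = mat 1" and \<theta>: "\<And>i. 0 \<le> \<theta> $ i"
  shows "norm_SF S (W ** (diag \<theta> - mat 1) ** transpose V)
       \<le> norm_SF S (W ** (diag \<theta> - L) ** transpose V)"
  unfolding norm_SF_factors[OF W V] column_diag_minus_one
  using norm_column_diag_minus[OF L \<theta>]
  by (intro real_sqrt_le_mono sum_mono power_mono) (simp_all add: norm_axis)

lemma STS_SVD_polar_optimal:
  fixes A W :: "real^('n::{finite,linorder})^'m"
  assumes svd: "STS_SVD S A W \<theta> V"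
  defines "P \<equiv> W ** transpose V"
  shows "P \<in> QS W V" and "A = P ** (V ** diag \<theta> ** transpose V)"
    and "is_arg_min (\<lambda>Q. norm_S2 S (A - Q)) (\<lambda>Q. Q \<in> QS W V) P"
    and "is_arg_min (\<lambda>Q. norm_SF S (A - Q)) (\<lambda>Q. Q \<in> QS W V) P"
proof -
  have A: "A = W ** diag \<theta> ** transpose V"
    and W: "transpose W ** transpose S ** S ** W = mat 1"
    and V: "transpose V ** V = mat 1" and \<theta>: "\<And>i. 0 \<le> \<theta> $ i"
    using svd by (auto simp: STS_SVD_def)
  have P: "P = W ** mat 1 ** transpose V"
    by (simp add: P_def)
  show mem: "P \<in> QS W V"
    unfolding QS_def using P by (intro CollectI exI[of _ "mat 1"]) simp
  have "P ** (V ** diag \<theta> ** transpose V)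
      = W ** (transpose V ** V) ** diag \<theta> ** transpose V"
    by (simp add: P_def matrix_mul_assoc)
  then show "A = P ** (V ** diag \<theta> ** transpose V)"
    by (simp add: V A)
  have diff: "A - W ** L ** transpose V = W ** (diag \<theta> - L) ** transpose V" for L
    unfolding A
    by (simp add: matrix_matrix_mult_def vec_eq_iff right_diff_distrib left_diff_distrib
        sum_subtractf)
  have "norm_S2 S (A - P) \<le> norm_S2 S (A - Q)" "norm_SF S (A - P) \<le> norm_SF S (A - Q)"
    if Q: "Q \<in> QS W V" for Q
  proof -
    obtain L where Q_eq: "Q = W ** L ** transpose V" and L: "transpose L ** L = mat 1"
      using Q by (auto simp: QS_def)
    show "norm_S2 S (A - P) \<le> norm_S2 S (A - Q)" "norm_SF S (A - P) \<le> norm_SF S (A - Q)"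
      unfolding P Q_eq diff
      using norm_S2_diag_minus_min[OF W V L \<theta>] norm_SF_diag_minus_min[OF W V L \<theta>] .
  qed
  with mem show "is_arg_min (\<lambda>Q. norm_S2 S (A - Q)) (\<lambda>Q. Q \<in> QS W V) P"
    and "is_arg_min (\<lambda>Q. norm_SF S (A - Q)) (\<lambda>Q. Q \<in> QS W V) P"
    by (auto simp: is_arg_min_def not_less)
qed

theorem theorem4:
  fixes M :: "'w measure"
    and S :: "'w \<Rightarrow> real^'m^'s"
    and A :: "real^('n::{finite,linorder})^'m"
    and \<epsilon> \<delta> :: real
  assumes "CARD('n) \<le> CARD('m)"
    and "random_subspace_embedding M S \<epsilon> \<delta> (rank A) (range ((*v) A))"
  shows "embedding_event M S \<epsilon> (range ((*v) A)) \<in> sets M \<and>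
    1 - \<delta> \<le> measure M (embedding_event M S \<epsilon> (range ((*v) A))) \<and>
    (\<forall>\<omega>\<in>embedding_event M S \<epsilon> (range ((*v) A)). \<forall>W \<theta> V.
       STS_SVD (S \<omega>) A W \<theta> V \<longrightarrow>
       (let P = W ** transpose V; H = V ** diag \<theta> ** transpose V in
          P \<in> QS W V \<and> A = P ** H \<and>
          is_arg_min (\<lambda>Q. norm_S2 (S \<omega>) (A - Q)) (\<lambda>Q. Q \<in> QS W V) P \<and>
          is_arg_min (\<lambda>Q. norm_SF (S \<omega>) (A - Q)) (\<lambda>Q. Q \<in> QS W V) P))"
proof -
  have "S \<in> borel_measurable M"
    and "1 - \<delta> \<le> measure M (embedding_event M S \<epsilon> (range ((*v) A)))"
    using assms(2) by (auto simp: random_subspace_embedding_def)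
  then show ?thesis
    unfolding Let_def
    by (intro conjI ballI allI impI embedding_event_sets STS_SVD_polar_optimal)
qed

end
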